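(* Let $K',K'':\mathbb{Z}^2\to\mathbb{Z}^2$ be defined by $K'(x,y)=(-x+y+1,\,y)$ and $K''(x,y)=(x,\,x-y+1)$, and let $a,b$ be integers. Then the following hold. (1) Starting with $(a,b)$ and applying the operators $K'$ and $K''$ alternately creates a cycle with six points. If any of these points lies on one of the lines $y=-x+2$, $2y=x+1$, $y=2x-1$, then some of the cycle points overlap, forming a cycle with only three distinct points, unless $a=b=1$, in which case all six points coincide. (2) The sets $\mathscr{P}_K(a,b)$, $(a,b)\in\mathbb{Z}^2$, form a partition of $\mathbb{Z}^2$ (any two of them are equal or disjoint, and their union is $\mathbb{Z}^2$). Moreover, for an integer $T\ge1$, the average, over the $(2T+1)^2$ lattice points $(a,b)$ with $-T\le a,b\le T$, of the Euclidean length of the closed path connecting consecutively the six points of the cycle generated by $(a,b)$ equals $\frac{17}{3}T+O(1)$. (3) There are infinitely many cycles $\mathscr{P}_K(a,b)$ for which the set $\{|m| : m\in\{x,y\},\ (x,y)\in\mathscr{P}_K(a,b)\}$ contains three distinct perfect squares, and infinitely many for which it contains three distinct perfect cubes. There exist cycles $\mathscr{P}_K(a,b)$ such that every element of $\{|m| : m\in\{x,y\},\ (x,y)\in\mathscr{P}_K(a,b)\}$ is a prime number.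
   Context: For $(a,b)\in\mathbb{Z}^2$, $\mathscr{P}_K(a,b)$ denotes the set of all points obtained from $(a,b)$ by applying finitely many (possibly zero) operators from $\{K',K''\}$, in any order; it is called the cycle generated by $(a,b)$. Applying $K',K'',K',K'',K',K''$ successively to $(x,y)$ gives the points $(-x+y+1,y)$, $(-x+y+1,-x+2)$, $(-y+2,-x+2)$, $(-y+2,x-y+1)$, $(x,x-y+1)$, $(x,y)$; the closed path of the cycle connects these six points in this order (returning to the start), and its length is the sum of the Euclidean lengths of the six segments. *)

theory Defs
  imports
    "HOL-Analysis.Analysis"
    "HOL-Library.Disjoint_Sets"
    "HOL-Computational_Algebra.Nth_Powers"
begin

definition K1 :: "int \<times> int \<Rightarrow> int \<times> int" where
  "K1 = (\<lambda>(x, y). (- x + y + 1, y))"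

definition K2 :: "int \<times> int \<Rightarrow> int \<times> int" where
  "K2 = (\<lambda>(x, y). (x, x - y + 1))"

inductive_set K_cycle :: "int \<times> int \<Rightarrow> (int \<times> int) set" for p :: "int \<times> int" where
  start: "p \<in> K_cycle p"
| K1: "q \<in> K_cycle p \<Longrightarrow> K1 q \<in> K_cycle p"
| K2: "q \<in> K_cycle p \<Longrightarrow> K2 q \<in> K_cycle p"

text \<open>The point reached from \<open>p\<close> after \<open>n\<close> steps \<open>f, g, f, g, \<dots>\<close>; the first step is \<open>f\<close>.\<close>

primrec alternate :: "('a \<Rightarrow> 'a) \<Rightarrow> ('a \<Rightarrow> 'a) \<Rightarrow> 'a \<Rightarrow> nat \<Rightarrow> 'a" where
  "alternate f g p 0 = p"
| "alternate f g p (Suc n) = (if even n then f else g) (alternate f g p n)"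

definition special_lines :: "(int \<times> int) set" where
  "special_lines = {(x, y). y = - x + 2 \<or> 2 * y = x + 1 \<or> y = 2 * x - 1}"

definition real_point :: "int \<times> int \<Rightarrow> real \<times> real" where
  "real_point = map_prod real_of_int real_of_int"

text \<open>The metric on \<^typ>\<open>real \<times> real\<close> is the Euclidean one.\<close>

definition path_length :: "int \<times> int \<Rightarrow> real" where
  "path_length p =
     (\<Sum>i<6. dist (real_point (alternate K1 K2 p i))
                 (real_point (alternate K1 K2 p (Suc i mod 6))))"

definition average_length :: "int \<Rightarrow> real" where
  "average_length T =
     (\<Sum>p\<in>{- T..T} \<times> {- T..T}. path_length p) / real_of_int ((2 * T + 1)\<^sup>2)"

definition abs_coords :: "(int \<times> int) set \<Rightarrow> int set" where
  "abs_coords S = {\<bar>m\<bar> | m x y. m \<in> {x, y} \<and> (x, y) \<in> S}"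

end

theory Submission
  imports Defs
begin

text \<open>In the coordinates \<open>u = x - 1\<close>, \<open>v = y - 1\<close> the operators become linear, the six points of a
  cycle have abscissas \<open>1 + \<alpha>\<close> and ordinates \<open>1 - \<alpha>\<close> with \<open>\<alpha>\<close> running through \<open>u\<close>, \<open>v - u\<close>, \<open>- v\<close>,
  and the closed path has length \<open>2 (|2u - v| + |u + v| + |u - 2v|)\<close>. Summing
  \<open>\<Sum>\<^sub>y |w - y|\<close> in closed form over \<open>w = x\<close> and \<open>w = 2x\<close> gives the average; undoing the shift
  by 1 costs only \<open>O(1)\<close>.

  The abscissas are three arbitrary integers with sum 3 and the ordinates are their reflections
  \<open>m \<mapsto> 2 - m\<close>. Hence solutions of \<open>s\<^sup>k + t\<^sup>k = w\<^sup>k + 1\<close> give cycles containing \<open>s\<^sup>k\<close>, \<open>t\<^sup>k\<close>, \<open>w\<^sup>k\<close>;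
  for \<open>k = 2, 3\<close> there are polynomial families of solutions.\<close>

section \<open>Cycles as explicit six-point sets, and the partition of the plane\<close>

lemma K1_pair: "K1 (x, y) = (- x + y + 1, y)"
  by (simp add: K1_def)

lemma K2_pair: "K2 (x, y) = (x, x - y + 1)"
  by (simp add: K2_def)

text \<open>The six listed points are closed under both operators, which gives one inclusion;
  walking around the hexagon with \<open>K1\<close> and \<open>K2\<close> in turn reaches each of
  them, which gives the other.\<close>

lemma K_cycle_eq:
  "K_cycle (x, y) = {(x, y), (- x + y + 1, y), (- x + y + 1, - x + 2),
     (- y + 2, - x + 2), (- y + 2, x - y + 1), (x, x - y + 1)}" (is "_ = ?H")
proof
  have "q \<in> ?H" if "q \<in> K_cycle (x, y)" for q
    using that by induction (auto simp: K1_def K2_def)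
  then show "K_cycle (x, y) \<subseteq> ?H" by blast
next
  have p0: "(x, y) \<in> K_cycle (x, y)" by (rule K_cycle.start)
  have p1: "(- x + y + 1, y) \<in> K_cycle (x, y)"
    using K_cycle.K1[OF p0] by (simp add: K1_def)
  have p2: "(- x + y + 1, - x + 2) \<in> K_cycle (x, y)"
    using K_cycle.K2[OF p1] by (simp add: K2_def)
  have p3: "(- y + 2, - x + 2) \<in> K_cycle (x, y)"
    using K_cycle.K1[OF p2] by (simp add: K1_def)
  have p4: "(- y + 2, x - y + 1) \<in> K_cycle (x, y)"
    using K_cycle.K2[OF p3] by (simp add: K2_def algebra_simps)
  have p5: "(x, x - y + 1) \<in> K_cycle (x, y)"
    using K_cycle.K1[OF p4] by (simp add: K1_def algebra_simps)
  show "?H \<subseteq> K_cycle (x, y)"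
    using p0 p1 p2 p3 p4 p5 by simp
qed

lemma finite_K_cycle: "finite (K_cycle p)"
  by (cases p) (simp add: K_cycle_eq)

lemma K_cycle_trans: "r \<in> K_cycle q \<Longrightarrow> q \<in> K_cycle p \<Longrightarrow> r \<in> K_cycle p"
  by (induction rule: K_cycle.induct) (auto intro: K_cycle.intros)

text \<open>Both operators are involutions, so every walk can be reversed. The proof checks this on
  the explicit lists.\<close>

lemma K_cycle_sym: "q \<in> K_cycle p \<Longrightarrow> p \<in> K_cycle q"
  by (cases p; cases q) (auto simp: K_cycle_eq)

lemma K_cycle_eqI: "q \<in> K_cycle p \<Longrightarrow> K_cycle q = K_cycle p"
  using K_cycle_trans K_cycle_sym by blast

lemma partition_on_K_cycle: "partition_on UNIV (range K_cycle)"
proof (rule partition_onI)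
  show "\<Union> (range K_cycle) = UNIV"
    using K_cycle.start by blast
next
  fix S S' assume "S \<in> range K_cycle" "S' \<in> range K_cycle" "S \<noteq> S'"
  then show "disjnt S S'"
    unfolding disjnt_def using K_cycle_eqI by blast
next
  show "{} \<notin> range K_cycle"
    using K_cycle.start by blast
qed

text \<open>Finitely many cycles, each finite, cover only finitely many points. This turns
  infinitely many generating points into infinitely many cycles.\<close>

lemma infinite_K_cycle_image:
  assumes "infinite P"
  shows "infinite (K_cycle ` P)"
proof
  assume "finite (K_cycle ` P)"
  then have "finite (\<Union> (K_cycle ` P))"
    using finite_K_cycle by auto
  moreover have "P \<subseteq> \<Union> (K_cycle ` P)"
    using K_cycle.start by blast
  ultimately show False
    using assms finite_subset by blast
qed

section \<open>Alternating application and the number of distinct points\<close>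

lemma alternate_add_6: "alternate f g p (n + 6) = alternate f g (alternate f g p 6) n"
proof (induction n)
  case (Suc n)
  \<comment> \<open>As 6 is even, \<open>n + 6\<close> and \<open>n\<close> have the same parity, so
    both sides apply the same operator next.\<close>
  have "Suc n + 6 = Suc (n + 6)" by simp
  then show ?case
    using Suc by (simp only: alternate.simps) simp
qed simp

lemma alternate_numeral:
  "alternate f g p (numeral k) =
     (if even (pred_numeral k) then f else g) (alternate f g p (pred_numeral k))"
  by (simp add: numeral_eq_Suc)

lemma lessThan_6: "{..<6::nat} = {0, 1, 2, 3, 4, 5}"
  by auto

text \<open>The two orders of application traverse the same hexagon in opposite directions.\<close>

lemma K_cycle_eq_alternate:
  assumes "(f, g) \<in> {(K1, K2), (K2, K1)}"
  shows "K_cycle p = alternate f g p ` {..<6}"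
proof (cases p)
  case (Pair x y)
  consider "f = K1" "g = K2" | "f = K2" "g = K1"
    using assms by auto
  then show ?thesis
    by cases (simp_all add: Pair lessThan_6 K_cycle_eq alternate_numeral K1_pair K2_pair insert_commute)
qed

lemma alternate_K_periodic:
  assumes "(f, g) \<in> {(K1, K2), (K2, K1)}"
  shows "alternate f g p (n + 6) = alternate f g p n"
proof -
  have "alternate f g p 6 = p"
    using assms by (cases p) (auto simp: alternate_numeral K1_pair K2_pair)
  then show ?thesis
    by (simp add: alternate_add_6)
qed

text \<open>\<open>K1\<close> fixes the line y = 2x - 1 pointwise and swaps the other two;
  \<open>K2\<close> fixes 2y = x + 1 pointwise and swaps the other two. Hence the union of the lines
  is invariant.\<close>

lemma K_cycle_special_lines_iff:
  "K_cycle p \<inter> special_lines \<noteq> {} \<longleftrightarrow> p \<in> special_lines"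
  by (cases p) (auto simp: K_cycle_eq special_lines_def)

text \<open>Any coincidence among the six points forces one of the three line equations on
  \<open>(x, y)\<close>.\<close>

lemma card_K_cycle_6:
  assumes "p \<notin> special_lines"
  shows "card (K_cycle p) = 6"
proof (cases p)
  case (Pair x y)
  then have "y \<noteq> - x + 2" "2 * y \<noteq> x + 1" "y \<noteq> 2 * x - 1"
    using assms by (auto simp: special_lines_def)
  then have "distinct [(x, y), (- x + y + 1, y), (- x + y + 1, - x + 2),
     (- y + 2, - x + 2), (- y + 2, x - y + 1), (x, x - y + 1)]"
    by simp
  from distinct_card[OF this] show ?thesis
    by (simp add: Pair K_cycle_eq)
qed

lemma card_K_cycle_3:
  assumes "p \<in> special_lines" "p \<noteq> (1, 1)"
  shows "card (K_cycle p) = 3"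
proof (cases p)
  case (Pair x y)
  \<comment> \<open>On each line the six points merge in pairs. The second equation is solved for
    \<open>x\<close>, so that every case leaves one integer parameter; two survivors can agree only
    when it is 1, that is, at \<open>(1, 1)\<close>.\<close>
  then consider "y = - x + 2" | "x = 2 * y - 1" | "y = 2 * x - 1"
    using assms by (fastforce simp: special_lines_def)
  then show ?thesis
  proof cases
    case 1
    then have "K_cycle p = {(x, - x + 2), (- 2 * x + 3, - x + 2), (x, 2 * x - 1)}"
      by (auto simp: Pair K_cycle_eq)
    moreover have "x \<noteq> 1"
      using 1 assms Pair by auto
    ultimately show ?thesis
      by (simp add: card_insert_if)
  next
    case 2
    then have "K_cycle p = {(2 * y - 1, y), (- y + 2, y), (- y + 2, - 2 * y + 3)}"
      by (auto simp: Pair K_cycle_eq)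
    moreover have "y \<noteq> 1"
      using 2 assms Pair by auto
    ultimately show ?thesis
      by (simp add: card_insert_if)
  next
    case 3
    then have "K_cycle p = {(x, 2 * x - 1), (x, - x + 2), (- 2 * x + 3, - x + 2)}"
      by (auto simp: Pair K_cycle_eq)
    moreover have "x \<noteq> 1"
      using 3 assms Pair by auto
    ultimately show ?thesis
      by (simp add: card_insert_if)
  qed
qed

section \<open>Length of the closed path and its average over a box\<close>

lemma path_length_eq:
  "path_length (x, y) = 2 * real_of_int (\<bar>2 * x - y - 1\<bar> + \<bar>x + y - 2\<bar> + \<bar>x - 2 * y + 1\<bar>)"
proof -
  let ?x = "real_of_int x" and ?y = "real_of_int y"
  \<comment> \<open>Each segment is horizontal or vertical, so its length is the absolute difference
    of a single coordinate. Opposite sides of the hexagon turn out equally long.\<close>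
  have "path_length (x, y) = \<bar>2 * ?x + (- ?y - 1)\<bar> + \<bar>?y - (2 - ?x)\<bar> + \<bar>2 * ?y - ?x - 1\<bar>
      + \<bar>1 + ?y - 2 * ?x\<bar> + \<bar>2 - ?y - ?x\<bar> + \<bar>?x + 1 - 2 * ?y\<bar>"
    by (simp add: path_length_def lessThan_6 alternate_numeral K1_pair K2_pair real_point_def
        dist_Pair_Pair dist_real_def)
  moreover have "\<bar>2 * ?x + (- ?y - 1)\<bar> = \<bar>2 * ?x - ?y - 1\<bar>"
    "\<bar>1 + ?y - 2 * ?x\<bar> = \<bar>2 * ?x - ?y - 1\<bar>"
    "\<bar>?y - (2 - ?x)\<bar> = \<bar>?x + ?y - 2\<bar>" "\<bar>2 - ?y - ?x\<bar> = \<bar>?x + ?y - 2\<bar>"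
    "\<bar>2 * ?y - ?x - 1\<bar> = \<bar>?x - 2 * ?y + 1\<bar>" "\<bar>?x + 1 - 2 * ?y\<bar> = \<bar>?x - 2 * ?y + 1\<bar>"
    by linarith+
  ultimately show ?thesis
    by simp
qed

lemma sum_int_symmetric:
  fixes f :: "int \<Rightarrow> int"
  assumes "\<And>x. f (- x) = f x"
  shows "(\<Sum>x = - int n..int n. f x) = f 0 + 2 * (\<Sum>k = 1..n. f (int k))"
proof (induction n)
  case (Suc n)
  have "{- int (Suc n)..int (Suc n)} = {int (Suc n), - int (Suc n)} \<union> {- int n..int n}"
    by auto
  then show ?case
    using Suc assms[of "int (Suc n)"] by (simp add: sum.union_disjoint)
qed simp

text \<open>The distances on either side of \<open>w\<close> add up to two triangular numbers,
  doubled here to stay within the integers. Starting from the single point \<open>w\<close>, the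
  interval grows first to the left, then to the right.\<close>

lemma sum_abs_diff_between:
  fixes a b w :: int
  assumes "a \<le> w" "w \<le> b"
  shows "2 * (\<Sum>y = a..b. \<bar>w - y\<bar>) = (w - a) * (w - a + 1) + (b - w) * (b - w + 1)"
  using assms(2)
proof (induction b rule: int_ge_induct)
  case base
  show ?case
    using assms(1)
  proof (induction a rule: int_le_induct)
    case (step a)
    then have "{a - 1..w} = insert (a - 1) {a..w}"
      by auto
    then show ?case
      using step by (simp add: algebra_simps)
  qed simp
next
  case (step b)
  then have "{a..b + 1} = insert (b + 1) {a..b}"
    using assms(1) by auto
  then show ?case
    using step by (simp add: algebra_simps)
qed

text \<open>No term changes sign, so this is an arithmetic series: number of terms times first plus
  last. The bound \<open>a - 1 \<le> b\<close> admits the empty interval, the base of the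
  induction.\<close>

lemma sum_abs_diff_above:
  fixes a b w :: int
  assumes "a - 1 \<le> b" "b \<le> w"
  shows "2 * (\<Sum>y = a..b. \<bar>w - y\<bar>) = (b - a + 1) * (2 * w - a - b)"
  using assms
proof (induction b rule: int_ge_induct)
  case (step b)
  then have "{a..b + 1} = insert (b + 1) {a..b}"
    by auto
  then show ?case
    using step by (simp add: algebra_simps)
qed simp

lemma sum_abs_diff_uminus:
  fixes n w :: int
  shows "(\<Sum>y = - n..n. \<bar>- w - y\<bar>) = (\<Sum>y = - n..n. \<bar>w - y\<bar>)"
  by (rule sum.reindex_bij_witness[of _ uminus uminus]) auto

lemma sum_abs_diff_inside:
  assumes "k \<le> n"
  shows "(\<Sum>y = - int n..int n. \<bar>int k - y\<bar>) = int n * (int n + 1) + (int k)\<^sup>2"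
  using sum_abs_diff_between[of "- int n" "int k" "int n"] assms
  by (simp add: power2_eq_square algebra_simps)

lemma sum_abs_diff_outside:
  assumes "n \<le> k"
  shows "(\<Sum>y = - int n..int n. \<bar>int k - y\<bar>) = (2 * int n + 1) * int k"
  using sum_abs_diff_above[of "- int n" "int n" "int k"] assms
  by (simp add: algebra_simps)

lemma sum_abs_add_box:
  "3 * (\<Sum>x = - int n..int n. \<Sum>y = - int n..int n. \<bar>x + y\<bar>)
     = 4 * int n * (int n + 1) * (2 * int n + 1)"
proof -
  \<comment> \<open>Reflecting \<open>y\<close> makes the column sums the ones already evaluated;
    they are even in \<open>x\<close>.\<close>
  have "(\<Sum>y = - int n..int n. \<bar>x + y\<bar>) = (\<Sum>y = - int n..int n. \<bar>x - y\<bar>)" for x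
    by (rule sum.reindex_bij_witness[of _ uminus uminus]) auto
  then have "(\<Sum>x = - int n..int n. \<Sum>y = - int n..int n. \<bar>x + y\<bar>)
      = (\<Sum>y = - int n..int n. \<bar>int 0 - y\<bar>)
        + 2 * (\<Sum>k = 1..n. \<Sum>y = - int n..int n. \<bar>int k - y\<bar>)"
    using sum_int_symmetric[where f = "\<lambda>x. \<Sum>y = - int n..int n. \<bar>x - y\<bar>", OF sum_abs_diff_uminus] by simp
  also have "(\<Sum>k = 1..n. \<Sum>y = - int n..int n. \<bar>int k - y\<bar>)
      = (\<Sum>k = 1..n. int n * (int n + 1) + (int k)\<^sup>2)"
    by (intro sum.cong refl sum_abs_diff_inside) auto
  also have "3 * ((\<Sum>y = - int n..int n. \<bar>int 0 - y\<bar>) + 2 * \<dots>)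
      = 4 * int n * (int n + 1) * (2 * int n + 1)"
  proof -
    have "6 * (\<Sum>k = 1..j. (int k)\<^sup>2) = int j * (int j + 1) * (2 * int j + 1)" for j
      by (induction j) (simp_all add: power2_eq_square algebra_simps)
    from this[of n] show ?thesis
      by (simp only: sum_abs_diff_inside[OF le0] sum.distrib sum_constant) (simp add: algebra_simps)
  qed
  finally show ?thesis .
qed

text \<open>The hypotheses say that \<open>m\<close> is \<open>n\<close> halved and rounded down.
  Thus \<open>2 * k\<close> lies in the summation range exactly for \<open>k \<le> m\<close>, and
  the closed form of the column sum changes there.\<close>

lemma sum_abs_double_diff_half:
  assumes "2 * m \<le> n" "n \<le> 2 * m + 1"
  shows "3 * (\<Sum>k = 1..n. \<Sum>y = - int n..int n. \<bar>2 * int k - y\<bar>)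
     = 3 * int m * int n * (int n + 1) + 2 * int m * (int m + 1) * (2 * int m + 1)
       + 3 * (2 * int n + 1) * (int n * (int n + 1) - int m * (int m + 1))"
proof -
  define h where "h = (\<lambda>k. \<Sum>y = - int n..int n. \<bar>2 * int k - y\<bar>)"
  have h_inside: "h k = int n * (int n + 1) + 4 * (int k)\<^sup>2" if "k \<le> m" for k
    using sum_abs_diff_inside[of "2 * k" n] that assms by (simp add: h_def power_mult_distrib)
  have h_outside: "h k = (2 * int n + 1) * (2 * int k)" if "m < k" for k
    using sum_abs_diff_outside[of n "2 * k"] that assms by (simp add: h_def)
  have "3 * (\<Sum>k = 1..j. h k)
      = 3 * int j * int n * (int n + 1) + 2 * int j * (int j + 1) * (2 * int j + 1)"
    if "j \<le> m" for j
    using that by (induction j) (simp_all add: h_inside power2_eq_square algebra_simps)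
  then have inside: "3 * (\<Sum>k = 1..m. h k)
      = 3 * int m * int n * (int n + 1) + 2 * int m * (int m + 1) * (2 * int m + 1)"
    by simp
  have "3 * (\<Sum>k = 1..j. h k) = 3 * (\<Sum>k = 1..m. h k)
      + 3 * (2 * int n + 1) * (int j * (int j + 1) - int m * (int m + 1))"
    if "m \<le> j" for j
    using that by (induction j rule: dec_induct) (simp_all add: h_outside algebra_simps)
  from this[of n] assms inside show ?thesis
    by (simp add: h_def)
qed

lemma sum_abs_double_diff_box:
  assumes "2 * m \<le> n" "n \<le> 2 * m + 1"
  shows "3 * (\<Sum>x = - int n..int n. \<Sum>y = - int n..int n. \<bar>2 * x - y\<bar>)
     = 3 * int n * (int n + 1) + 6 * int m * int n * (int n + 1)
       + 4 * int m * (int m + 1) * (2 * int m + 1)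
       + 6 * (2 * int n + 1) * (int n * (int n + 1) - int m * (int m + 1))"
proof -
  have "(\<Sum>y = - int n..int n. \<bar>2 * (- x) - y\<bar>) = (\<Sum>y = - int n..int n. \<bar>2 * x - y\<bar>)" for x
    using sum_abs_diff_uminus[where w = "2 * x"] by simp
  then have "(\<Sum>x = - int n..int n. \<Sum>y = - int n..int n. \<bar>2 * x - y\<bar>)
      = (\<Sum>y = - int n..int n. \<bar>2 * 0 - y\<bar>)
        + 2 * (\<Sum>k = 1..n. \<Sum>y = - int n..int n. \<bar>2 * int k - y\<bar>)"
    by (rule sum_int_symmetric)
  moreover have "(\<Sum>y = - int n..int n. \<bar>2 * 0 - y\<bar>) = int n * (int n + 1)"
    using sum_abs_diff_inside[of 0 n] by simp
  ultimately show ?thesis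
    using sum_abs_double_diff_half[OF assms] by (simp add: algebra_simps)
qed

text \<open>The integral of |2x - y| over the square of side 2n is 13/3 n^3, which is 13/12 n times
  its area. For each parity of \<open>n\<close> the exact error is a quadratic in \<open>m\<close>
  with nonnegative coefficients, none larger than those of
  \<open>(2 * real n + 1)\<^sup>2\<close>.\<close>

lemma sum_abs_double_diff_box_approx:
  "\<bar>real_of_int (\<Sum>x = - int n..int n. \<Sum>y = - int n..int n. \<bar>2 * x - y\<bar>)
      - 13 / 12 * real n * (2 * real n + 1)\<^sup>2\<bar> \<le> (2 * real n + 1)\<^sup>2"
proof -
  define m where "m = n div 2"
  define A where "A = (\<Sum>x = - int n..int n. \<Sum>y = - int n..int n. \<bar>2 * x - y\<bar>)"
  have m: "2 * m \<le> n" "n \<le> 2 * m + 1"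
    by (auto simp: m_def)
  have A: "3 * real_of_int A = 3 * real n * (real n + 1) + 6 * real m * real n * (real n + 1)
       + 4 * real m * (real m + 1) * (2 * real m + 1)
       + 6 * (2 * real n + 1) * (real n * (real n + 1) - real m * (real m + 1))"
    using arg_cong[OF sum_abs_double_diff_box[OF m], of real_of_int] by (simp add: A_def)
  from m consider "n = 2 * m" | "n = 2 * m + 1"
    by linarith
  then have "\<bar>real_of_int A - 13 / 12 * real n * (2 * real n + 1)\<^sup>2\<bar> \<le> (2 * real n + 1)\<^sup>2"
  proof cases
    case 1
    have "real_of_int A - 13 / 12 * real n * (2 * real n + 1)\<^sup>2 = 26 / 3 * (real m)\<^sup>2 + 19 / 6 * real m"
      using A by (simp add: 1 power2_eq_square power3_eq_cube algebra_simps)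
    moreover have "(2 * real n + 1)\<^sup>2 = 16 * (real m)\<^sup>2 + 8 * real m + 1"
      by (simp add: 1 power2_eq_square algebra_simps)
    ultimately show ?thesis
      using zero_le_power2[of "real m"] by linarith
  next
    case 2
    have "real_of_int A - 13 / 12 * real n * (2 * real n + 1)\<^sup>2 = 26 / 3 * (real m)\<^sup>2 + 71 / 6 * real m + 17 / 4"
      using A by (simp add: 2 power2_eq_square power3_eq_cube algebra_simps add_divide_distrib)
    moreover have "(2 * real n + 1)\<^sup>2 = 16 * (real m)\<^sup>2 + 24 * real m + 9"
      by (simp add: 2 power2_eq_square algebra_simps)
    ultimately show ?thesis
      using zero_le_power2[of "real m"] by linarith
  qed
  then show ?thesis
    by (simp add: A_def)
qed

lemma sum_path_length_approx:
  "\<bar>(\<Sum>p \<in> {- int n..int n} \<times> {- int n..int n}. path_length p)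
      - 17 / 3 * real n * (2 * real n + 1)\<^sup>2\<bar> \<le> 14 * (2 * real n + 1)\<^sup>2"
proof -
  let ?I = "{- int n..int n}"
  define N where "N = (2 * real n + 1)\<^sup>2"
  define A where "A = (\<Sum>x \<in> ?I. \<Sum>y \<in> ?I. \<bar>2 * x - y\<bar>)"
  define B where "B = (\<Sum>x \<in> ?I. \<Sum>y \<in> ?I. \<bar>x + y\<bar>)"
  \<comment> \<open>\<open>D\<close> is the path length with the constant shifts dropped.\<close>
  define D where "D = (\<lambda>x y. 2 * (\<bar>2 * x - y\<bar> + \<bar>x + y\<bar> + \<bar>x - 2 * y\<bar>) :: int)"
  have A': "(\<Sum>x \<in> ?I. \<Sum>y \<in> ?I. \<bar>x - 2 * y\<bar>) = A"
    unfolding A_def by (subst sum.swap) (simp only: abs_minus_commute)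
  have D: "(\<Sum>x \<in> ?I. \<Sum>y \<in> ?I. D x y) = 2 * (2 * A + B)"
    unfolding D_def by (simp add: sum.distrib A' flip: sum_distrib_left A_def B_def)
  have A: "\<bar>real_of_int A - 13 / 12 * real n * N\<bar> \<le> N"
    unfolding A_def N_def by (rule sum_abs_double_diff_box_approx)
  have "3 * real_of_int B = 4 * real n * (real n + 1) * (2 * real n + 1)"
    using arg_cong[OF sum_abs_add_box[of n], of real_of_int] by (simp add: B_def)
  then have "real_of_int B - 2 / 3 * real n * N = 2 / 3 * real n * (2 * real n + 1)"
    by (simp add: N_def power2_eq_square algebra_simps)
  moreover have "\<dots> \<le> (2 * real n + 1) * (2 * real n + 1)"
    by (intro mult_right_mono) auto
  ultimately have B: "\<bar>real_of_int B - 2 / 3 * real n * N\<bar> \<le> N"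
    by (simp add: N_def power2_eq_square del: times_divide_eq_left times_divide_eq_right)
  \<comment> \<open>The dropped constants are 1, 2 and 1 in absolute value, and their sum is
    doubled.\<close>
  have "\<bar>path_length (x, y) - real_of_int (D x y)\<bar> \<le> 8" for x y
  proof -
    have shift: "\<bar>c - d\<bar> \<le> \<bar>c\<bar> + e" "\<bar>c\<bar> \<le> \<bar>c - d\<bar> + e" if "\<bar>d\<bar> \<le> e" for c d e :: int
      using that by linarith+
    have "\<bar>2 * (\<bar>2 * x - y - 1\<bar> + \<bar>x + y - 2\<bar> + \<bar>x - 2 * y + 1\<bar>) - D x y\<bar> \<le> 8"
      unfolding D_def
      using shift[of 1 1 "2 * x - y"] shift[of 2 2 "x + y"] shift[of "- 1" 1 "x - 2 * y"]
      by (intro abs_leI) simp_all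
    then have "real_of_int \<bar>2 * (\<bar>2 * x - y - 1\<bar> + \<bar>x + y - 2\<bar> + \<bar>x - 2 * y + 1\<bar>) - D x y\<bar> \<le> 8"
      by linarith
    then show ?thesis
      by (simp add: path_length_eq)
  qed
  then have "\<bar>\<Sum>p \<in> ?I \<times> ?I. path_length p - real_of_int (case_prod D p)\<bar>
      \<le> (\<Sum>p \<in> ?I \<times> ?I. 8)"
    by (intro order.trans[OF sum_abs] sum_mono) auto
  also have "\<dots> = 8 * N"
    by (simp add: N_def power2_eq_square card_cartesian_product)
  finally have "\<bar>(\<Sum>p \<in> ?I \<times> ?I. path_length p) - real_of_int (\<Sum>p \<in> ?I \<times> ?I. case_prod D p)\<bar> \<le> 8 * N"
    by (simp add: sum_subtractf)
  then have "\<bar>(\<Sum>p \<in> ?I \<times> ?I. path_length p) - 2 * (2 * real_of_int A + real_of_int B)\<bar> \<le> 8 * N"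
    by (simp only: sum.cartesian_product[symmetric] D) simp
  \<comment> \<open>The main term is 2 (2 * 13/12 + 2/3) = 17/3, and the error is 8 + 2 (2 * 1 + 1)
    = 14.\<close>
  with A B have "\<bar>(\<Sum>p \<in> ?I \<times> ?I. path_length p) - 17 / 3 * (real n * N)\<bar> \<le> 14 * N"
    by (simp add: abs_le_iff algebra_simps)
  then show ?thesis
    by (simp add: N_def)
qed

lemma average_length_approx:
  assumes "T \<ge> 1"
  shows "\<bar>average_length T - 17 / 3 * real_of_int T\<bar> \<le> 14"
proof -
  obtain n where T: "T = int n"
    using assms by (metis nonneg_int_cases order.trans zero_le_one)
  define N where "N = (2 * real n + 1)\<^sup>2"
  define S where "S = (\<Sum>p \<in> {- int n..int n} \<times> {- int n..int n}. path_length p)"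
  have N: "N > 0"
    by (simp add: N_def)
  have "average_length T - 17 / 3 * real_of_int T = (S - 17 / 3 * real n * N) / N"
    using N by (simp add: average_length_def T S_def N_def diff_divide_distrib)
  also have "\<bar>\<dots>\<bar> \<le> 14"
    using N sum_path_length_approx[of n] by (simp add: S_def N_def abs_divide divide_le_eq)
  finally show ?thesis .
qed

section \<open>Squares, cubes and primes among the coordinates\<close>

lemma abs_coords_K_cycle:
  "abs_coords (K_cycle (x, y)) =
     {\<bar>x\<bar>, \<bar>- x + y + 1\<bar>, \<bar>- y + 2\<bar>, \<bar>y\<bar>, \<bar>- x + 2\<bar>, \<bar>x - y + 1\<bar>}"
  unfolding abs_coords_def K_cycle_eq by blast

lemma infinite_power_cycles:
  fixes s t w :: "nat \<Rightarrow> int"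
  assumes eq: "\<And>k. k \<in> I \<Longrightarrow> s k ^ j + t k ^ j = w k ^ j + 1"
    and card: "\<And>k. k \<in> I \<Longrightarrow> card {\<bar>s k\<bar> ^ j, \<bar>t k\<bar> ^ j, \<bar>w k\<bar> ^ j} = 3"
    and inf: "infinite ((\<lambda>k. s k ^ j) ` I)"
  shows "infinite {S \<in> range K_cycle. \<exists>A \<subseteq> abs_coords S. card A = 3 \<and> (\<forall>m\<in>A. is_nth_power j m)}"
    (is "infinite ?C")
proof -
  \<comment> \<open>For such a point the coordinates \<open>x\<close>, \<open>- y + 2\<close> and
    \<open>x - y + 1\<close> of its cycle are \<open>s k ^ j\<close>, \<open>t k ^ j\<close> and, by
    \<open>eq\<close>, \<open>w k ^ j\<close>.\<close>
  define P where "P = (\<lambda>k. (s k ^ j, 2 - t k ^ j)) ` I"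
  have "infinite P"
  proof
    assume "finite P"
    then have "finite (fst ` P)" by simp
    then show False
      using inf by (simp add: P_def image_image)
  qed
  then have "infinite (K_cycle ` P)"
    by (rule infinite_K_cycle_image)
  moreover have "K_cycle ` P \<subseteq> ?C"
  proof clarify
    fix x y assume "(x, y) \<in> P"
    then obtain k where k: "k \<in> I" "x = s k ^ j" "y = 2 - t k ^ j"
      by (auto simp: P_def)
    have "x - y + 1 = w k ^ j"
      using eq[OF k(1)] k by simp
    then have "{\<bar>s k\<bar> ^ j, \<bar>t k\<bar> ^ j, \<bar>w k\<bar> ^ j} \<subseteq> abs_coords (K_cycle (x, y))"
      using k by (simp add: abs_coords_K_cycle power_abs)
    with card[OF k(1)]
    show "K_cycle (x, y) \<in> range K_cycle \<and>
        (\<exists>A \<subseteq> abs_coords (K_cycle (x, y)). card A = 3 \<and> (\<forall>m\<in>A. is_nth_power j m))"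
      by (intro conjI rangeI exI[of _ "{\<bar>s k\<bar> ^ j, \<bar>t k\<bar> ^ j, \<bar>w k\<bar> ^ j}"]) auto
  qed
  ultimately show ?thesis
    using finite_subset by blast
qed

lemma card_three_powers:
  fixes a b c :: int
  assumes "0 < j" "0 \<le> a" "a < b" "b < c"
  shows "card {a ^ j, b ^ j, c ^ j} = 3"
proof -
  have "a ^ j < b ^ j" "b ^ j < c ^ j"
    using assms by (auto intro!: power_strict_mono)
  then show ?thesis
    by (simp add: card_insert_if)
qed

lemma infinite_square_cycles:
  "infinite {S \<in> range K_cycle. \<exists>A \<subseteq> abs_coords S. card A = 3 \<and> (\<forall>m\<in>A. is_nth_power 2 m)}"
\<comment> \<open>Taking w = t + 1 reduces s^2 + t^2 = w^2 + 1 to s^2 = 2w, solved by s = 2k. At k =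
  1 the values s and w would coincide.\<close>
proof (rule infinite_power_cycles[where I = "{2..}" and s = "\<lambda>k. 2 * int k"
      and t = "\<lambda>k. 2 * (int k)\<^sup>2 - 1" and w = "\<lambda>k. 2 * (int k)\<^sup>2"])
  fix k :: nat assume "k \<in> {2..}"
  then have k: "int k \<ge> 2" by simp
  then have "2 * int k \<le> (int k)\<^sup>2"
    by (simp add: power2_eq_square)
  then show "card {\<bar>2 * int k\<bar>\<^sup>2, \<bar>2 * (int k)\<^sup>2 - 1\<bar>\<^sup>2, \<bar>2 * (int k)\<^sup>2\<bar>\<^sup>2} = 3"
    using k by (intro card_three_powers) linarith+
next
  have "inj_on (\<lambda>k. (2 * int k)\<^sup>2) {2..}"
    by (auto simp: inj_on_def)
  then show "infinite ((\<lambda>k. (2 * int k)\<^sup>2) ` {2..})"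
    by (simp add: finite_image_iff infinite_Ici)
qed (simp add: power2_eq_square algebra_simps)

lemma infinite_cube_cycles:
  "infinite {S \<in> range K_cycle. \<exists>A \<subseteq> abs_coords S. card A = 3 \<and> (\<forall>m\<in>A. is_nth_power 3 m)}"
\<comment> \<open>This is Mahler's family of solutions of X^3 + Y^3 + Z^3 = 1, with w = -Z. For k at
  least 2 the absolute values are ordered |w| < |t| < |s|.\<close>
proof (rule infinite_power_cycles[where I = "{2..}" and s = "\<lambda>k. 9 * int k ^ 4"
      and t = "\<lambda>k. 3 * int k - 9 * int k ^ 4" and w = "\<lambda>k. 9 * int k ^ 3 - 1"])
  fix k :: nat assume "k \<in> {2..}"
  then have k: "int k \<ge> 2" by simp
  then have "2 * int k ^ 3 \<le> int k * int k ^ 3"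
    by (intro mult_right_mono) auto
  then have "2 * int k ^ 3 \<le> int k ^ 4"
    by (simp add: eval_nat_numeral)
  moreover have "int k \<le> int k ^ 3"
    using k by (intro self_le_power) auto
  ultimately have "card {\<bar>9 * int k ^ 3 - 1\<bar> ^ 3, \<bar>3 * int k - 9 * int k ^ 4\<bar> ^ 3, \<bar>9 * int k ^ 4\<bar> ^ 3} = 3"
    using k by (intro card_three_powers) linarith+
  then show "card {\<bar>9 * int k ^ 4\<bar> ^ 3, \<bar>3 * int k - 9 * int k ^ 4\<bar> ^ 3, \<bar>9 * int k ^ 3 - 1\<bar> ^ 3} = 3"
    by (simp only: insert_commute)
next
  have "inj_on (\<lambda>k. (9 * int k ^ 4) ^ 3) {2..}"
    by (auto simp: inj_on_def power_mult_distrib power_eq_iff_eq_base simp flip: power_mult)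
  then show "infinite ((\<lambda>k. (9 * int k ^ 4) ^ 3) ` {2..})"
    by (simp add: finite_image_iff infinite_Ici)
qed (simp add: eval_nat_numeral algebra_simps)

text \<open>The abscissas 7, 7, -11 have sum 3, and their reflections -5, -5, 13 are the ordinates;
  up to sign these are the twin primes 5, 7 and 11, 13.\<close>

lemma prime_cycle: "\<forall>m \<in> abs_coords (K_cycle (7, - 5)). prime m"
proof -
  have "prime (5::nat)" "prime (7::nat)" "prime (11::nat)" "prime (13::nat)"
    by simp_all
  then have "prime (5::int)" "prime (7::int)" "prime (11::int)" "prime (13::int)"
    by (metis of_nat_numeral prime_nat_int_transfer)+
  then show ?thesis
    by (simp add: abs_coords_K_cycle)
qed

theorem theorem1p1:
  fixes a b :: int
  shows
    "(\<forall>(f, g) \<in> {(K1, K2), (K2, K1)}.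
        let pt = alternate f g (a, b); pts = pt ` {..<6} in
          (\<forall>n. pt (n + 6) = pt n) \<and>
          K_cycle (a, b) = pts \<and>
          (pts \<inter> special_lines = {} \<longrightarrow> card pts = 6) \<and>
          (pts \<inter> special_lines \<noteq> {} \<and> \<not> (a = 1 \<and> b = 1) \<longrightarrow> card pts = 3) \<and>
          (a = 1 \<and> b = 1 \<longrightarrow> (\<forall>i<6. \<forall>j<6. pt i = pt j)))
     \<and>
     (partition_on UNIV (range K_cycle) \<and>
      (\<exists>C. \<forall>T\<ge>1. \<bar>average_length T - 17 / 3 * real_of_int T\<bar> \<le> C))
     \<and>
     (infinite {S \<in> range K_cycle.
         \<exists>A \<subseteq> abs_coords S. card A = 3 \<and> (\<forall>m\<in>A. is_nth_power 2 m)} \<and>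
      infinite {S \<in> range K_cycle.
         \<exists>A \<subseteq> abs_coords S. card A = 3 \<and> (\<forall>m\<in>A. is_nth_power 3 m)} \<and>
      (\<exists>S \<in> range K_cycle. \<forall>m \<in> abs_coords S. prime m))"
proof (intro conjI)
  show "\<exists>C. \<forall>T\<ge>1. \<bar>average_length T - 17 / 3 * real_of_int T\<bar> \<le> C"
    using average_length_approx by blast
  have cycle: "let pt = alternate f g (a, b); pts = pt ` {..<6} in
          (\<forall>n. pt (n + 6) = pt n) \<and>
          K_cycle (a, b) = pts \<and>
          (pts \<inter> special_lines = {} \<longrightarrow> card pts = 6) \<and>
          (pts \<inter> special_lines \<noteq> {} \<and> \<not> (a = 1 \<and> b = 1) \<longrightarrow> card pts = 3) \<and>
          (a = 1 \<and> b = 1 \<longrightarrow> (\<forall>i<6. \<forall>j<6. pt i = pt j))"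
    if fg: "(f, g) \<in> {(K1, K2), (K2, K1)}" for f g
  proof -
    \<comment> \<open>\<open>(1, 1)\<close> is the common fixed point of both operators.\<close>
    have "alternate f g (1, 1) i = (1, 1)" for i
      using fg by (induction i) (auto simp: K1_pair K2_pair)
    then show ?thesis
      using alternate_K_periodic[OF fg] card_K_cycle_6[of "(a, b)"] card_K_cycle_3[of "(a, b)"]
        K_cycle_special_lines_iff[of "(a, b)"]
      unfolding Let_def K_cycle_eq_alternate[OF fg, symmetric] by auto
  qed
  show "\<forall>(f, g) \<in> {(K1, K2), (K2, K1)}.
        let pt = alternate f g (a, b); pts = pt ` {..<6} in
          (\<forall>n. pt (n + 6) = pt n) \<and>
          K_cycle (a, b) = pts \<and>
          (pts \<inter> special_lines = {} \<longrightarrow> card pts = 6) \<and>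
          (pts \<inter> special_lines \<noteq> {} \<and> \<not> (a = 1 \<and> b = 1) \<longrightarrow> card pts = 3) \<and>
          (a = 1 \<and> b = 1 \<longrightarrow> (\<forall>i<6. \<forall>j<6. pt i = pt j))"
    using cycle by (intro ballI) (simp only: split_paired_all prod.case)
qed (use partition_on_K_cycle infinite_square_cycles infinite_cube_cycles prime_cycle in blast)+

end
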